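(* For every integer $r\ge1$, the poset $IR(r,\mathbb F_2)$ is simply connected, i.e. its geometric realization $|IR(r,\mathbb F_2)|$ is simply connected.
   Context: A matroid is binary if it is representable over $\mathbb F_2$. A binary matroid is regular if it has no minor isomorphic to the Fano matroid $F_7$ (the linear matroid on the seven nonzero vectors of $\mathbb F_2^3$) or to its dual $F_7^*$ (by Tutte's theorem this is equivalent to the usual definitions of regular matroid). Any subset of $\mathbb F_2^r$ is regarded as a matroid in which independence is linear independence over $\mathbb F_2$. For $r\ge1$, $IR(r,\mathbb F_2)$ is the poset, ordered by inclusion, of all subsets of $\mathbb F_2^r\setminus\{0\}$ which are regular matroids of rank $r$. The geometric realization $|P|$ of a poset $P$ is the geometric realization of its order complex, the simplicial complex whose $k$-simplices are the chains $x_0<x_1<\cdots<x_k$ in $P$. *)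

theory Defs
  imports "HOL-Analysis.Analysis" "HOL-Library.Z2" "HOL-Library.Numeral_Type"
begin

text \<open>The field with two elements is the type \<^typ>\<open>bit\<close>, and the vector space of
  dimension r over it is \<^typ>\<open>bit ^ 'n\<close> with r = \<^term>\<open>CARD('n::finite)\<close>.  Finiteness of
  \<^typ>\<open>bit\<close> makes \<^typ>\<open>(bit ^ 'n::finite) set\<close> a finite type as well.\<close>

instance bit :: finite
proof
  have "(UNIV :: bit set) \<subseteq> {0, 1}"
    by (metis bit_not_zero_iff insertCI subsetI)
  then show "finite (UNIV :: bit set)"
    by (rule finite_subset) simp
qed


section \<open>Matroids\<close>

record 'a matroid =
  ground :: "'a set"
  indep :: "'a set set"

definition is_matroid :: "'a matroid \<Rightarrow> bool" where
  "is_matroid M \<longleftrightarrow>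
     finite (ground M) \<and> indep M \<subseteq> Pow (ground M) \<and> {} \<in> indep M \<and>
     (\<forall>I\<in>indep M. \<forall>J. J \<subseteq> I \<longrightarrow> J \<in> indep M) \<and>
     (\<forall>I\<in>indep M. \<forall>J\<in>indep M. card I < card J \<longrightarrow> (\<exists>x\<in>J - I. insert x I \<in> indep M))"

definition bases :: "'a matroid \<Rightarrow> 'a set set" where
  "bases M = {B \<in> indep M. \<forall>I\<in>indep M. B \<subseteq> I \<longrightarrow> I = B}"

definition matroid_rank :: "'a matroid \<Rightarrow> nat" where
  "matroid_rank M = Max (card ` indep M)"

text \<open>The bases of the dual are the complements of the bases, so a set is independent in the
  dual iff it avoids some basis.\<close>

definition dual :: "'a matroid \<Rightarrow> 'a matroid" where
  "dual M = \<lparr>ground = ground M, indep = {I. I \<subseteq> ground M \<and> (\<exists>B\<in>bases M. I \<inter> B = {})}\<rparr>"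

definition delete :: "'a matroid \<Rightarrow> 'a set \<Rightarrow> 'a matroid" where
  "delete M X = \<lparr>ground = ground M - X, indep = {I \<in> indep M. I \<subseteq> ground M - X}\<rparr>"

definition contract :: "'a matroid \<Rightarrow> 'a set \<Rightarrow> 'a matroid" where
  "contract M X = dual (delete (dual M) X)"

definition is_minor :: "'a matroid \<Rightarrow> 'a matroid \<Rightarrow> bool" where
  "is_minor N M \<longleftrightarrow>
     (\<exists>X Y. X \<subseteq> ground M \<and> Y \<subseteq> ground M \<and> X \<inter> Y = {} \<and> N = delete (contract M X) Y)"

definition matroid_iso :: "'a matroid \<Rightarrow> 'b matroid \<Rightarrow> bool" where
  "matroid_iso M N \<longleftrightarrow>
     (\<exists>f. bij_betw f (ground M) (ground N) \<and>
          (\<forall>I. I \<subseteq> ground M \<longrightarrow> (I \<in> indep M \<longleftrightarrow> f ` I \<in> indep N)))"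

definition has_minor_iso :: "'a matroid \<Rightarrow> 'b matroid \<Rightarrow> bool" where
  "has_minor_iso M N \<longleftrightarrow> (\<exists>M'. is_minor M' M \<and> matroid_iso M' N)"

definition linear_matroid :: "(bit ^ 'n::finite) set \<Rightarrow> (bit ^ 'n) matroid" where
  "linear_matroid S = \<lparr>ground = S, indep = {I. I \<subseteq> S \<and> vec.independent I}\<rparr>"

text \<open>Representability over the two-element field by a matrix \<open>A\<close> with \<open>r\<close> rows whose columns
  are labelled by the ground set: a set is independent iff the corresponding indexed family of
  columns is linearly independent (so a repeated column is a dependency).\<close>

definition binary :: "'a matroid \<Rightarrow> bool" where
  "binary M \<longleftrightarrow> is_matroid M \<and>
     (\<exists>(r::nat) (A :: nat \<Rightarrow> 'a \<Rightarrow> bit). \<forall>I. I \<subseteq> ground M \<longrightarrow>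
        (I \<in> indep M \<longleftrightarrow>
          (\<forall>c :: 'a \<Rightarrow> bit. (\<forall>i<r. (\<Sum>e\<in>I. c e * A i e) = 0) \<longrightarrow> (\<forall>e\<in>I. c e = 0))))"

definition fano :: "(bit ^ 3) matroid" where
  "fano = linear_matroid (UNIV - {0})"

definition regular :: "'a matroid \<Rightarrow> bool" where
  "regular M \<longleftrightarrow> binary M \<and> \<not> has_minor_iso M fano \<and> \<not> has_minor_iso M (dual fano)"

lemma is_matroid_linear_matroid: "is_matroid (linear_matroid (S :: (bit ^ 'n::finite) set))"
proof -
  have "\<exists>x\<in>J - I. insert x I \<subseteq> S \<and> vec.independent (insert x I)"
    if IJ: "I \<subseteq> S" "vec.independent I" "J \<subseteq> S" "vec.independent J" "card I < card J"
    for I J :: "(bit ^ 'n) set"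
  proof -
    have "\<not> J \<subseteq> vec.span I"
      using vec.independent_span_bound[of I J] IJ by auto
    then obtain x where x: "x \<in> J" "x \<notin> vec.span I"
      by blast
    have "vec.independent (insert x I)"
      by (rule vec.independent_insertI[OF x(2) IJ(2)])
    moreover have "x \<notin> I"
      using x(2) vec.span_base by blast
    ultimately show ?thesis
      using x(1) IJ(1,3) by auto
  qed
  note exchange = this
  let ?M = "linear_matroid S"
  have indep_iff: "I \<in> indep ?M \<longleftrightarrow> I \<subseteq> S \<and> vec.independent I" for I
    by (simp add: linear_matroid_def)
  have ground: "ground ?M = S"
    by (simp add: linear_matroid_def)
  show ?thesis
    unfolding is_matroid_def
  proof (intro conjI ballI allI impI)
    show "finite (ground ?M)"
      by (rule finite)
    show "indep ?M \<subseteq> Pow (ground ?M)"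
      using indep_iff ground by blast
    show "{} \<in> indep ?M"
      unfolding indep_iff using vec.independent_empty by blast
    show "J \<in> indep ?M" if "I \<in> indep ?M" "J \<subseteq> I" for I J
      using that vec.independent_mono[of I J] unfolding indep_iff by (meson subset_trans)
    show "\<exists>x\<in>J - I. insert x I \<in> indep ?M"
      if "I \<in> indep ?M" "J \<in> indep ?M" "card I < card J" for I J
      using exchange[of I J] that unfolding indep_iff by meson
  qed
qed

lemma binary_linear_matroid: "binary (linear_matroid (S :: (bit ^ 'n::finite) set))"
proof -
  obtain h where h: "bij_betw h {..<CARD('n)} (UNIV :: 'n set)"
    using ex_bij_betw_nat_finite[of "UNIV :: 'n set"] by (auto simp: atLeast0LessThan)
  define A where "A = (\<lambda>i (v :: bit ^ 'n). v $ h i)"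
  have "(\<forall>i<CARD('n). (\<Sum>e\<in>I. c e * A i e) = 0) \<longleftrightarrow> (\<Sum>e\<in>I. c e *s e) = 0"
    for I :: "(bit ^ 'n) set" and c
  proof -
    have "(\<forall>i<CARD('n). (\<Sum>e\<in>I. c e * A i e) = 0) \<longleftrightarrow>
        (\<forall>j\<in>h ` {..<CARD('n)}. (\<Sum>e\<in>I. c e * e $ j) = 0)"
      by (auto simp: A_def)
    also have "\<dots> \<longleftrightarrow> (\<forall>j. (\<Sum>e\<in>I. c e * e $ j) = 0)"
      by (simp add: bij_betw_imp_surj_on[OF h] del: sum_eq_0_iff)
    also have "\<dots> \<longleftrightarrow> (\<Sum>e\<in>I. c e *s e) = 0"
      unfolding vec_eq_iff sum_component vector_smult_component zero_index ..
    finally show ?thesis .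
  qed
  moreover have "vec.independent I \<longleftrightarrow>
      (\<forall>c. (\<Sum>e\<in>I. c e *s e) = 0 \<longrightarrow> (\<forall>e\<in>I. c e = 0))" for I :: "(bit ^ 'n) set"
    by (auto simp: vec.dependent_finite)
  ultimately have repr: "\<forall>I. I \<subseteq> ground (linear_matroid S) \<longrightarrow> (I \<in> indep (linear_matroid S) \<longleftrightarrow>
      (\<forall>c. (\<forall>i<CARD('n). (\<Sum>e\<in>I. c e * A i e) = 0) \<longrightarrow> (\<forall>e\<in>I. c e = 0)))"
    by (simp add: linear_matroid_def)
  show ?thesis
    unfolding binary_def by (intro conjI exI) (rule is_matroid_linear_matroid, rule repr)
qed

definition IR :: "(bit ^ 'n::finite) set set" where
  "IR = {S. S \<subseteq> UNIV - {0} \<and> regular (linear_matroid S) \<and>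
            matroid_rank (linear_matroid S) = CARD('n)}"


section \<open>Geometric realization of a poset\<close>

definition order_complex :: "'a::order set \<Rightarrow> 'a set set" where
  "order_complex P =
     {C. C \<noteq> {} \<and> finite C \<and> C \<subseteq> P \<and> (\<forall>x\<in>C. \<forall>y\<in>C. x \<le> y \<or> y \<le> x)}"

text \<open>The points of the realization are given by barycentric coordinates.  The vertex type is
  finite, hence so is the complex, and the weak topology on the realization is the subspace
  topology inherited from \<^typ>\<open>real ^ 'v\<close>.\<close>

definition geometric_realization :: "'v::finite set set \<Rightarrow> (real ^ 'v) set" where
  "geometric_realization K =
     {t. (\<forall>v. 0 \<le> t $ v) \<and> (\<Sum>v\<in>UNIV. t $ v) = 1 \<and> {v. t $ v \<noteq> 0} \<in> K}"

definition poset_realization :: "'a::{finite,order} set \<Rightarrow> (real ^ 'a::{finite,order}) set" where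
  "poset_realization P = geometric_realization (order_complex P)"

end

(*
  A regular set stays regular when shrunk to a spanning subset, and every spanning
  subset of size at most r + 2 is regular: a minor has corank at most the corank of the matroid,
  while the Fano matroid and its dual have coranks 4 and 3.  These properties alone force simple
  connectivity, for families of spanning sets of any finite matroid.

  For an independent set F, let Q_F be the members of the family containing F.  If F is a basis, Q_F
  is a cone with apex F.  To pass from Q_{F + e} to Q_F, insert the missing sets T one at a time:
  first, by decreasing size, those with T + e in Q, whose links are conically connected through
  T + e; then, by increasing size, those with T + e not in Q.  The latter have size at least r + 2
  and their links consist of all proper spanning subsets of T containing F, which are connected by
  basis exchange.  Inserting an element with connected link preserves simple connectivity, by the
  easy half of the Seifert-van Kampen theorem.
*)

theory Submission
  imports Defs
begin

section \<open>Unions of simply connected spaces\<close>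

text \<open>A loop based at a point of the intersection is cut into arcs that each stay in
  \<open>U\<close> or in \<open>V\<close>. Each initial part is then deformed, arc by arc, into a
  path inside just one of the two sets. Other base points are reached by conjugation.\<close>

lemma simply_connected_Un_open:
  fixes U V :: "'a::real_normed_vector set"
  assumes U: "openin (top_of_set (U \<union> V)) U" "simply_connected U"
    and V: "openin (top_of_set (U \<union> V)) V" "simply_connected V"
    and UV: "path_connected (U \<inter> V)" "U \<inter> V \<noteq> {}"
  shows "simply_connected (U \<union> V)"
proof -
  define S where "S = U \<union> V"
  obtain a where a: "a \<in> U" "a \<in> V"
    using UV(2) by blast
  obtain U' V' where U': "open U'" "U = S \<inter> U'" and V': "open V'" "V = S \<inter> V'"
    using U(1) V(1) unfolding openin_open S_def by blast
  have homotopic: "homotopic_paths S q q'"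
    if "W \<in> {U, V}" "path q" "path_image q \<subseteq> W" "path q'" "path_image q' \<subseteq> W"
      "pathstart q = pathstart q'" "pathfinish q = pathfinish q'" for W q q'
  proof -
    have "homotopic_paths W q q'"
      using that U(2) V(2) simply_connected_eq_homotopic_paths[of W] by force
    then show ?thesis
      by (rule homotopic_paths_subset) (use that S_def in auto)
  qed
  have connected: "\<exists>q. path q \<and> path_image q \<subseteq> W \<and> pathstart q = a \<and> pathfinish q = y"
    if "W \<in> {U, V, U \<inter> V}" "y \<in> W" for W y
    using that a UV(1) U(2) V(2) simply_connected_imp_path_connected
    unfolding path_connected_def by (metis IntI insertE singletonD)
  have "homotopic_paths S p (linepath a a)"
    if p: "path p" "path_image p \<subseteq> S" "pathstart p = a" "pathfinish p = a" for p
  proof -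
    have cont: "continuous_on {0..1} p"
      using p(1) by (simp add: path_def)
    have cover: "path_image p \<subseteq> \<Union>{U', V'}"
      using p(2) U'(2) V'(2) S_def by blast
    \<comment> \<open>A Lebesgue number for the cover of the loop; uniform continuity turns it into
      the mesh 1/\<open>N\<close> of a subdivision of the interval.\<close>
    obtain \<epsilon> where \<epsilon>: "0 < \<epsilon>" "\<And>x. x \<in> path_image p \<Longrightarrow> \<exists>G\<in>{U', V'}. ball x \<epsilon> \<subseteq> G"
      by (rule Heine_Borel_lemma[of "path_image p" "{U', V'}"])
        (use U'(1) V'(1) compact_path_image[OF p(1)] cover in auto)
    obtain \<delta> where \<delta>: "0 < \<delta>"
      "\<And>x y. x \<in> {0..1} \<Longrightarrow> y \<in> {0..1} \<Longrightarrow> dist y x < \<delta> \<Longrightarrow> dist (p y) (p x) < \<epsilon>"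
      using compact_uniformly_continuous[OF cont compact_Icc] \<epsilon>(1)
      unfolding uniformly_continuous_on_def by metis
    obtain N :: nat where N: "N > 0" "1 / real N < \<delta>"
      using real_arch_inverse[of \<delta>] \<delta>(1) by (auto simp: field_simps)
    have mem: "real k / real N \<in> {0..1}" if "k \<le> N" for k
      using that N(1) by (auto simp: field_simps)
    have piece: "\<exists>W\<in>{U, V}. p ` {real k / N..real (Suc k) / N} \<subseteq> W" if k: "k < N" for k
    proof -
      have "p (k / N) \<in> path_image p"
        using mem[of k] k by (auto simp: path_image_def)
      then obtain G where G: "G \<in> {U', V'}" "ball (p (k / N)) \<epsilon> \<subseteq> G"
        using \<epsilon>(2) by blast
      have "p x \<in> S \<inter> G" if x: "x \<in> {real k / N..real (Suc k) / N}" for x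
      proof -
        have "real k / N \<in> {0..1}" "real (Suc k) / N \<in> {0..1}"
          using mem k by (auto simp del: atLeastAtMost_iff of_nat_Suc)
        then have "x \<in> {0..1}"
          using x unfolding atLeastAtMost_iff by linarith
        moreover have "dist x (k / N) < \<delta>"
          using x N by (auto simp: dist_real_def add_divide_distrib)
        ultimately have "dist (p x) (p (k / N)) < \<epsilon>" "p x \<in> S"
          using \<delta>(2) mem[of k] k p(2) by (auto simp: path_image_def)
        then show ?thesis
          using G(2) by (auto simp: dist_commute)
      qed
      then show ?thesis
        using G(1) U'(2) V'(2) by blast
    qed
    \<comment> \<open>Induction over the cut points. Both \<open>W\<close> and \<open>q\<close> are
      quantified, because the next arc may lie in the other set and the comparison path must then be
      replaced.\<close>
    have "\<forall>W q. W \<in> {U, V} \<and> path q \<and> path_image q \<subseteq> W \<and> pathstart q = a \<and> pathfinish q = p (k / N)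
        \<longrightarrow> homotopic_paths S (subpath 0 (k / N) p) q" if "k \<le> N" for k
      using that
    proof (induction k)
      case 0
      show ?case
      proof (intro allI impI, elim conjE)
        fix W q
        assume q: "W \<in> {U, V}" "path q" "path_image q \<subseteq> W" "pathstart q = a"
          "pathfinish q = p (real 0 / N)"
        show "homotopic_paths S (subpath 0 (real 0 / N) p) q"
          by (rule homotopic[OF q(1)])
            (use q p(3) a in \<open>auto simp: pathstart_def pathfinish_def path_image_def subpath_def path_def\<close>)
      qed
    next
      case (Suc k)
      let ?s = "real k / N" and ?t = "real (Suc k) / N"
      have s: "?s \<in> {0..1}" and t: "?t \<in> {0..1}" and st: "?s \<le> ?t"
        using mem[of k] mem[of "Suc k"] Suc.prems by (auto simp: divide_right_mono)
      obtain W where W: "W \<in> {U, V}" "p ` {?s..?t} \<subseteq> W"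
        using piece[of k] Suc.prems by auto
      have ends: "p ?s \<in> W" "p ?t \<in> W"
        using W(2) st by (auto simp del: of_nat_Suc)
      obtain q0 where q0: "path q0" "path_image q0 \<subseteq> W" "pathstart q0 = a" "pathfinish q0 = p ?s"
        using connected[of W "p ?s"] W(1) ends(1) by blast
      have sub: "path (subpath ?s ?t p)" "path_image (subpath ?s ?t p) \<subseteq> W"
        using p(1) s t st W(2) by (auto simp: path_image_subpath path_subpath)
      have "W \<subseteq> S"
        using W(1) S_def by auto
      have "homotopic_paths S (subpath 0 ?s p) q0"
        using Suc W(1) q0 by simp
      then have "homotopic_paths S (subpath 0 ?s p +++ subpath ?s ?t p) (q0 +++ subpath ?s ?t p)"
        by (rule homotopic_paths_join) (use sub \<open>W \<subseteq> S\<close> in \<open>auto simp: homotopic_paths_refl\<close>)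
      moreover have "homotopic_paths S (subpath 0 ?s p +++ subpath ?s ?t p) (subpath 0 ?t p)"
        by (rule homotopic_join_subpaths) (use p s t in auto)
      ultimately have hom0: "homotopic_paths S (subpath 0 ?t p) (q0 +++ subpath ?s ?t p)"
        using homotopic_paths_sym homotopic_paths_trans by blast
      have q1: "path (q0 +++ subpath ?s ?t p)" "path_image (q0 +++ subpath ?s ?t p) \<subseteq> W"
        "pathstart (q0 +++ subpath ?s ?t p) = a" "pathfinish (q0 +++ subpath ?s ?t p) = p ?t"
        using q0 sub by (auto simp: path_image_join)
      show ?case
      proof (intro allI impI, elim conjE)
        fix W' q
        assume q: "W' \<in> {U, V}" "path q" "path_image q \<subseteq> W'" "pathstart q = a" "pathfinish q = p ?t"
        \<comment> \<open>The path \<open>r\<close> mediates the change of set: \<open>q0\<close>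
          followed by the arc is homotopic to \<open>r\<close> within \<open>W\<close>, and
          \<open>r\<close> to \<open>q\<close> within \<open>W'\<close>. If the sets differ, this is
          where path connectedness of \<open>U \<inter> V\<close> enters.\<close>
        have "\<exists>r. path r \<and> path_image r \<subseteq> W \<inter> W' \<and> pathstart r = a \<and> pathfinish r = p ?t"
        proof (rule connected)
          show "W \<inter> W' \<in> {U, V, U \<inter> V}"
            using W(1) q(1) by auto
          show "p ?t \<in> W \<inter> W'"
            using ends(2) q(3,5) pathfinish_in_path_image[of q] by auto
        qed
        then obtain r where r: "path r" "path_image r \<subseteq> W \<inter> W'" "pathstart r = a" "pathfinish r = p ?t"
          by blast
        have "homotopic_paths S (q0 +++ subpath ?s ?t p) r"
          by (rule homotopic[OF W(1)]) (use q1 r in auto)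
        moreover have "homotopic_paths S r q"
          by (rule homotopic[OF q(1)]) (use q r in auto)
        ultimately show "homotopic_paths S (subpath 0 ?t p) q"
          using hom0 homotopic_paths_trans by blast
      qed
    qed
    \<comment> \<open>At \<open>k = N\<close> the constant path at \<open>a\<close> serves as
      \<open>q\<close>.\<close>
    from this[of N] show ?thesis
      using N(1) a(1) p(4) by (force simp: pathfinish_def)
  qed
  then have "homotopic_loops S p (linepath a a)"
    if "path p" "path_image p \<subseteq> S" "pathfinish p = pathstart p" "pathstart p = a" for p
    using that homotopic_paths_imp_homotopic_loops[of S p "linepath a a"] by simp
  note loop = this
  have path_conn: "path_connected S"
    unfolding S_def
    by (rule path_connected_Un) (use U V UV simply_connected_imp_path_connected in auto)
  show ?thesis
    unfolding S_def[symmetric] simply_connected_eq_contractible_path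
  proof (intro conjI allI impI path_conn, elim conjE)
    fix p
    assume p: "path p" "path_image p \<subseteq> S" "pathfinish p = pathstart p"
    have "pathstart p \<in> S" "a \<in> S"
      using p a S_def by auto
    then obtain g where g: "path g" "path_image g \<subseteq> S" "pathstart g = a" "pathfinish g = pathstart p"
      using path_conn unfolding path_connected_def by meson
    have "homotopic_loops S (g +++ p +++ reversepath g) p"
      by (rule homotopic_loops_conjugate) (use p g in auto)
    moreover have "homotopic_loops S (g +++ p +++ reversepath g) (linepath a a)"
      by (rule loop) (use g p in \<open>auto simp: path_image_join\<close>)
    ultimately have "homotopic_loops S p (linepath a a)"
      using homotopic_loops_sym homotopic_loops_trans by blast
    then show "homotopic_paths S p (linepath (pathstart p) (pathstart p))"
      by (rule homotopic_loops_imp_homotopic_paths_null)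
  qed
qed

section \<open>Realizations of finite posets\<close>

lemma axis_nth_if: "axis x a $ y = (if y = x then a else 0)"
  by (simp add: axis_def)

text \<open>The support is nonempty because the coordinates sum to 1, and finite because the vertex
  type is; of the conditions on it only membership in \<open>P\<close> and comparability
  remain.\<close>

lemma mem_poset_realization:
  "t \<in> poset_realization P \<longleftrightarrow>
     (\<forall>v. 0 \<le> t $ v) \<and> (\<Sum>v\<in>UNIV. t $ v) = 1 \<and> (\<forall>x. t $ x \<noteq> 0 \<longrightarrow> x \<in> P) \<and>
     (\<forall>x y. t $ x \<noteq> 0 \<longrightarrow> t $ y \<noteq> 0 \<longrightarrow> x \<le> y \<or> y \<le> x)"
proof -
  have "{v. t $ v \<noteq> 0} \<noteq> {}" if "(\<Sum>v\<in>UNIV. t $ v) = 1"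
    using that by (metis (mono_tags, lifting) empty_Collect_eq sum.neutral zero_neq_one)
  then show ?thesis
    by (auto simp: poset_realization_def geometric_realization_def order_complex_def)
qed

lemma axis_in_poset_realization: "axis x 1 \<in> poset_realization P \<longleftrightarrow> x \<in> P"
proof -
  have "(\<Sum>v\<in>UNIV. axis x 1 $ v) = (1::real)"
    by (simp add: axis_nth_if)
  then show ?thesis
    by (auto simp: mem_poset_realization axis_nth_if split: if_splits)
qed

lemma poset_realization_mono: "P \<subseteq> P' \<Longrightarrow> poset_realization P \<subseteq> poset_realization P'"
  unfolding mem_poset_realization subset_iff by blast

lemma closed_segment_nth:
  fixes s t :: "real ^ 'n"
  assumes "w \<in> closed_segment s t"
  obtains u where "0 \<le> u" "u \<le> 1" "\<And>v. w $ v = (1 - u) * s $ v + u * t $ v"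
  using assms by (auto simp: in_segment)

text \<open>The support of a point of the segment lies in the union of the two end supports. Each of
  these is a chain already, so comparability across them suffices.\<close>

lemma segment_subset_poset_realization:
  assumes s: "s \<in> poset_realization P" and t: "t \<in> poset_realization P"
    and chain: "\<And>x y. s $ x \<noteq> 0 \<Longrightarrow> t $ y \<noteq> 0 \<Longrightarrow> x \<le> y \<or> y \<le> x"
  shows "closed_segment s t \<subseteq> poset_realization P"
proof
  fix w
  assume "w \<in> closed_segment s t"
  then obtain u where u: "0 \<le> u" "u \<le> 1" and coord: "\<And>v. w $ v = (1 - u) * s $ v + u * t $ v"
    by (rule closed_segment_nth) blast
  have "(\<Sum>v\<in>UNIV. w $ v) = (1 - u) * (\<Sum>v\<in>UNIV. s $ v) + u * (\<Sum>v\<in>UNIV. t $ v)"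
    by (simp add: coord sum.distrib sum_distrib_left)
  then have "(\<Sum>v\<in>UNIV. w $ v) = 1"
    using s t by (simp add: mem_poset_realization)
  moreover have "0 \<le> w $ v" for v
    using s t u by (simp add: mem_poset_realization coord)
  moreover have supp: "s $ v \<noteq> 0 \<or> t $ v \<noteq> 0" if "w $ v \<noteq> 0" for v
    using that by (auto simp: coord)
  moreover have "x \<le> y \<or> y \<le> x" if "w $ x \<noteq> 0" "w $ y \<noteq> 0" for x y
    using supp[OF that(1)] supp[OF that(2)] chain s t unfolding mem_poset_realization by blast
  ultimately show "w \<in> poset_realization P"
    using s t unfolding mem_poset_realization by blast
qed

definition comparable_on :: "'a::order set \<Rightarrow> 'a \<Rightarrow> 'a \<Rightarrow> bool" where
  "comparable_on P x y \<longleftrightarrow> x \<in> P \<and> y \<in> P \<and> (x \<le> y \<or> y \<le> x)"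

text \<open>Connectedness of the comparability graph, which is the 1-skeleton of the order complex.
  Nonemptiness is included so that a connected link also yields a nonempty overlap in the gluing
  step.\<close>

definition order_connected :: "'a::order set \<Rightarrow> bool" where
  "order_connected P \<longleftrightarrow> P \<noteq> {} \<and>
     (\<forall>x\<in>P. \<forall>y\<in>P. (comparable_on P)\<^sup>*\<^sup>* x y)"

text \<open>A point is joined, within its simplex, to a vertex of its support, and comparable
  vertices span an edge.\<close>

lemma path_connected_poset_realization:
  assumes "order_connected P"
  shows "path_connected (poset_realization P)"
proof -
  let ?R = "poset_realization P"
  have edge: "path_component ?R (axis x 1) (axis y 1)" if "x \<in> P" "y \<in> P" "x \<le> y \<or> y \<le> x" for x y
    by (rule path_component_linepath, rule segment_subset_poset_realization)
      (use that in \<open>auto simp: axis_in_poset_realization axis_nth_if split: if_splits\<close>)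
  have vertices: "path_component ?R (axis x 1) (axis y 1)" if xy: "x \<in> P" "y \<in> P" for x y
  proof -
    have "(comparable_on P)\<^sup>*\<^sup>* x y"
      using assms xy unfolding order_connected_def by blast
    then show ?thesis
    proof (induction rule: rtranclp_induct)
      case base
      then show ?case
        using xy(1) by (simp add: path_component_refl axis_in_poset_realization)
    next
      case (step y z)
      then show ?case
        using edge[of y z] by (auto simp: comparable_on_def intro: path_component_trans)
    qed
  qed
  have to_vertex: "\<exists>x\<in>P. path_component ?R t (axis x 1)" if t: "t \<in> ?R" for t
  proof -
    obtain x where x: "t $ x \<noteq> 0"
      using t unfolding mem_poset_realization by (metis sum.neutral zero_neq_one)
    have "x \<in> P"
      using t x by (simp add: mem_poset_realization)
    moreover have "path_component ?R t (axis x 1)"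
    proof (rule path_component_linepath, rule segment_subset_poset_realization[OF t])
      show "axis x 1 \<in> ?R"
        using \<open>x \<in> P\<close> by (simp add: axis_in_poset_realization)
      show "y \<le> z \<or> z \<le> y" if "t $ y \<noteq> 0" "axis x 1 $ z \<noteq> (0::real)" for y z
        using that t x by (auto simp: mem_poset_realization axis_nth_if split: if_splits)
    qed
    ultimately show ?thesis
      by blast
  qed
  show ?thesis
    unfolding path_connected_component
    by (meson path_component_sym path_component_trans to_vertex vertices)
qed

section \<open>Open stars, cones and radial projection from a vertex\<close>

lemma starlike_star:
  assumes z: "z \<in> P"
  shows "starlike {t \<in> poset_realization P. 0 < t $ z}"
  unfolding starlike_def
proof (intro bexI ballI)
  show "axis z 1 \<in> {t \<in> poset_realization P. 0 < t $ z}"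
    using z by (simp add: axis_in_poset_realization)
  fix t
  assume t: "t \<in> {t \<in> poset_realization P. 0 < t $ z}"
  \<comment> \<open>The support of \<open>t\<close> is a chain containing \<open>z\<close>, so all
    of it is comparable with \<open>z\<close>.\<close>
  have "closed_segment (axis z 1) t \<subseteq> poset_realization P"
  proof (rule segment_subset_poset_realization)
    show "x \<le> y \<or> y \<le> x" if "axis z (1::real) $ x \<noteq> 0" "t $ y \<noteq> 0" for x y
      using that t by (auto simp: mem_poset_realization axis_nth_if split: if_splits)
  qed (use t z in \<open>auto simp: axis_in_poset_realization\<close>)
  moreover have "0 < w $ z" if w: "w \<in> closed_segment (axis z 1) t" for w
  proof -
    obtain u where u: "0 \<le> u" "u \<le> 1" "w $ z = (1 - u) + u * t $ z"
      using w by (rule closed_segment_nth) (simp add: axis_nth_if)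
    show ?thesis
      using t u by (cases "u = 0") (auto intro: add_nonneg_pos)
  qed
  ultimately show "closed_segment (axis z 1) t \<subseteq> {t \<in> poset_realization P. 0 < t $ z}"
    by auto
qed

text \<open>Adding \<open>z\<close> to a chain in \<open>P\<close> leaves a chain, so the
  realization is starlike from the vertex \<open>z\<close>.\<close>

lemma simply_connected_cone:
  assumes z: "z \<in> P" and comparable: "\<And>x. x \<in> P \<Longrightarrow> x \<le> z \<or> z \<le> x"
  shows "simply_connected (poset_realization P)"
proof (rule starlike_imp_simply_connected)
  show "starlike (poset_realization P)"
    unfolding starlike_def
  proof (intro bexI ballI)
    show "axis z 1 \<in> poset_realization P"
      using z by (simp add: axis_in_poset_realization)
    fix t
    assume t: "t \<in> poset_realization P"
    show "closed_segment (axis z 1) t \<subseteq> poset_realization P"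
    proof (rule segment_subset_poset_realization)
      show "x \<le> y \<or> y \<le> x" if "axis z (1::real) $ x \<noteq> 0" "t $ y \<noteq> 0" for x y
        using that t comparable[of y] by (auto simp: mem_poset_realization axis_nth_if split: if_splits)
    qed (use t z in \<open>auto simp: axis_in_poset_realization\<close>)
  qed
qed

text \<open>Projection from the vertex \<open>z\<close> onto the opposite face, for points with
  \<open>t $ z < 1\<close>; the factor rescales the remaining coordinates to sum 1.\<close>

definition radial :: "'a::finite \<Rightarrow> real ^ 'a \<Rightarrow> real ^ 'a" where
  "radial z t = (1 / (1 - t $ z)) *\<^sub>R (t - t $ z *\<^sub>R axis z 1)"

lemma radial_nth: "radial z t $ x = (if x = z then 0 else t $ x / (1 - t $ z))"
  by (simp add: radial_def axis_nth_if)

lemma radial_in: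
  assumes t: "t \<in> poset_realization P" "t $ z < 1"
  shows "radial z t \<in> poset_realization (P - {z})"
proof -
  have "(\<Sum>x\<in>UNIV. radial z t $ x) = (\<Sum>x\<in>UNIV - {z}. t $ x / (1 - t $ z))"
    by (rule sum.mono_neutral_cong_right) (auto simp: radial_nth)
  also have "\<dots> = (\<Sum>x\<in>UNIV - {z}. t $ x) / (1 - t $ z)"
    by (simp add: sum_divide_distrib)
  also have "(\<Sum>x\<in>UNIV - {z}. t $ x) = 1 - t $ z"
    using t(1) by (simp add: mem_poset_realization sum_diff1)
  finally have "(\<Sum>x\<in>UNIV. radial z t $ x) = 1"
    using t(2) by simp
  then show ?thesis
    using t by (auto simp: mem_poset_realization radial_nth split: if_splits)
qed

lemma radial_in_link:
  assumes t: "t \<in> poset_realization P" "t $ z < 1" "0 < t $ z"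
  shows "radial z t \<in> poset_realization {x \<in> P. x < z \<or> z < x}"
proof -
  have "x < z \<or> z < x" if "radial z t $ x \<noteq> 0" for x
    using that t by (fastforce simp: radial_nth mem_poset_realization less_le split: if_splits)
  then show ?thesis
    using radial_in[OF t(1,2)] by (auto simp: mem_poset_realization)
qed

text \<open>The realization is the union of the open star \<open>U\<close> of \<open>z\<close> and
  the complement \<open>V\<close> of the vertex \<open>z\<close>. Radially, \<open>V\<close>
  contracts onto the realization without \<open>z\<close>, and the overlap onto a copy of the link
  of \<open>z\<close>.\<close>

lemma simply_connected_insert:
  fixes P :: "'a::{finite,order} set"
  assumes z: "z \<in> P" and sc: "simply_connected (poset_realization (P - {z}))"
    and link: "order_connected {x \<in> P. x < z \<or> z < x}"
  shows "simply_connected (poset_realization P)"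
proof -
  let ?R = "poset_realization P" and ?A = "poset_realization (P - {z})"
    and ?L = "poset_realization {x \<in> P. x < z \<or> z < x}"
  define U where "U = {t \<in> ?R. 0 < t $ z}"
  define V where "V = {t \<in> ?R. t $ z < 1}"
  have AV: "?A \<subseteq> V"
  proof
    fix t
    assume t: "t \<in> ?A"
    then have "t $ z = 0"
      by (auto simp: mem_poset_realization)
    then show "t \<in> V"
      using t poset_realization_mono[of "P - {z}" P] by (auto simp: V_def)
  qed
  have UV: "U \<union> V = ?R"
    by (auto simp: U_def V_def)
  have coord: "continuous_on X (\<lambda>t :: (real, 'a) vec. t $ z)" for X
    by (intro continuous_intros)
  have "U = ?R \<inter> {t. 0 < t $ z}" "V = ?R \<inter> {t. t $ z < 1}"
    by (auto simp: U_def V_def)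
  moreover have "open {t :: (real, 'a) vec. 0 < t $ z}" "open {t :: (real, 'a) vec. t $ z < 1}"
    by (auto intro!: open_Collect_less continuous_intros)
  ultimately have "openin (top_of_set (U \<union> V)) U" "openin (top_of_set (U \<union> V)) V"
    unfolding UV openin_open by blast+
  moreover have "simply_connected U"
    unfolding U_def by (intro starlike_imp_simply_connected starlike_star z)
  moreover have "simply_connected V"
  proof -
    obtain x where x: "x \<in> P" "x \<noteq> z"
      using link unfolding order_connected_def by auto
    define a where "a = (axis x 1 :: (real, 'a) vec)"
    have a: "a \<in> ?A"
      using x by (simp add: a_def axis_in_poset_realization)
    have "homotopic_loops V p (linepath a a)"
      if p: "path p" "path_image p \<subseteq> V" "pathfinish p = pathstart p" for p
    proof -
      have pV: "p t \<in> V" if "t \<in> {0..1}" for t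
        using p(2) that by (auto simp: path_image_def)
      have cont: "continuous_on V (radial z)"
        unfolding radial_def by (intro continuous_intros) (auto simp: V_def)
      have q: "path (radial z \<circ> p)" "pathfinish (radial z \<circ> p) = pathstart (radial z \<circ> p)"
        using p cont path_continuous_image[of p "radial z"] continuous_on_subset
        by (auto simp: pathfinish_def pathstart_def)
      \<comment> \<open>A straight-line homotopy: projecting only removes \<open>z\<close> from the
        support, and the \<open>z\<close>-coordinate does not increase along the segment, so the
        vertex \<open>z\<close> is avoided.\<close>
      have "homotopic_loops V p (radial z \<circ> p)"
      proof (rule homotopic_loops_linear[OF p(1) q(1) p(3) q(2)])
        fix t :: real
        assume "t \<in> {0..1}"
        then have pt: "p t \<in> ?R" "p t $ z < 1"
          using pV by (auto simp: V_def)
        have r: "radial z (p t) \<in> ?A"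
          using radial_in pt by blast
        have "closed_segment (p t) (radial z (p t)) \<subseteq> ?R"
        proof (rule segment_subset_poset_realization[OF pt(1)])
          show "radial z (p t) \<in> ?R"
            using r AV by (auto simp: V_def)
          show "x \<le> y \<or> y \<le> x" if "p t $ x \<noteq> 0" "radial z (p t) $ y \<noteq> 0" for x y
            using that pt(1) by (auto simp: mem_poset_realization radial_nth split: if_splits)
        qed
        moreover have "w $ z < 1" if w: "w \<in> closed_segment (p t) (radial z (p t))" for w
        proof -
          obtain u where u: "0 \<le> u" "u \<le> 1" "w $ z = (1 - u) * p t $ z"
            using w by (rule closed_segment_nth) (simp add: radial_nth)
          have "(1 - u) * p t $ z \<le> 1 * p t $ z"
            using u pt(1) by (intro mult_right_mono) (auto simp: mem_poset_realization)
          then show ?thesis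
            using u pt(2) by simp
        qed
        ultimately show "closed_segment (p t) ((radial z \<circ> p) t) \<subseteq> V"
          by (auto simp: V_def)
      qed
      moreover have "homotopic_loops V (radial z \<circ> p) (linepath a a)"
      proof (rule homotopic_loops_subset[OF _ AV])
        have "path_image (radial z \<circ> p) \<subseteq> ?A"
          using pV radial_in[of _ P z] by (force simp: path_image_def V_def)
        then show "homotopic_loops ?A (radial z \<circ> p) (linepath a a)"
          using sc q a unfolding simply_connected_eq_contractible_loop_any by blast
      qed
      ultimately show ?thesis
        by (rule homotopic_loops_trans)
    qed
    then show ?thesis
      using a AV unfolding simply_connected_eq_contractible_loop_all by blast
  qed
  moreover have "path_connected (U \<inter> V) \<and> U \<inter> V \<noteq> {}"
  proof -
    \<comment> \<open>\<open>h\<close> moves the link halfway towards the vertex \<open>z\<close>,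
      to \<open>z\<close>-coordinate 1/2, and so into the overlap.\<close>
    define h where "h = (\<lambda>t :: (real, 'a) vec. (1/2) *\<^sub>R axis z 1 + (1/2) *\<^sub>R t)"
    have Lz: "s $ z = 0" if "s \<in> ?L" for s
      using that by (auto simp: mem_poset_realization)
    have hz: "h s $ z = 1/2" if "s \<in> ?L" for s
      using Lz[OF that] by (simp add: h_def)
    have hR: "h s \<in> ?R" if s: "s \<in> ?L" for s
    proof -
      have "h s \<in> closed_segment (axis z 1) s"
        unfolding h_def in_segment by (intro exI[of _ "1/2"]) auto
      also have "\<dots> \<subseteq> ?R"
      proof (rule segment_subset_poset_realization)
        show "s \<in> ?R"
          using s poset_realization_mono[of "{x \<in> P. x < z \<or> z < x}" P] by auto
        show "x \<le> y \<or> y \<le> x" if "axis z (1::real) $ x \<noteq> 0" "s $ y \<noteq> 0" for x y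
          using that s by (auto simp: mem_poset_realization axis_nth_if split: if_splits)
      qed (use z in \<open>simp add: axis_in_poset_realization\<close>)
      finally show ?thesis .
    qed
    have hUV: "h s \<in> U \<inter> V" if "s \<in> ?L" for s
      using hz[OF that] hR[OF that] by (simp add: U_def V_def)
    have "path_connected (h ` ?L)"
    proof (rule path_connected_continuous_image)
      show "continuous_on ?L h"
        unfolding h_def by (intro continuous_intros)
      show "path_connected ?L"
        by (rule path_connected_poset_realization[OF link])
    qed
    then have image: "path_component (U \<inter> V) (h s) (h s')" if "s \<in> ?L" "s' \<in> ?L" for s s'
      using that hUV unfolding path_connected_component
      by (meson image_eqI image_subsetI path_component_of_subset)
    \<comment> \<open>Along this segment the \<open>z\<close>-coordinate stays between
      \<open>t $ z\<close> and 1/2, hence strictly between 0 and 1.\<close>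
    have to_image: "path_component (U \<inter> V) t (h (radial z t))" if t: "t \<in> U \<inter> V" for t
    proof (rule path_component_linepath)
      have t': "t \<in> ?R" "t $ z < 1" "0 < t $ z"
        using t by (auto simp: U_def V_def)
      have r: "radial z t \<in> ?L"
        using radial_in_link t' by blast
      have "closed_segment t (h (radial z t)) \<subseteq> ?R"
      proof (rule segment_subset_poset_realization[OF t'(1) hR[OF r]])
        show "x \<le> y \<or> y \<le> x" if "t $ x \<noteq> 0" "h (radial z t) $ y \<noteq> 0" for x y
          using that t' by (auto simp: mem_poset_realization h_def radial_nth axis_nth_if split: if_splits)
      qed
      moreover have "0 < w $ z \<and> w $ z < 1" if w: "w \<in> closed_segment t (h (radial z t))" for w
      proof -
        obtain u where u: "0 \<le> u" "u \<le> 1" and wz: "w $ z = (1 - u) * t $ z + u * (1/2)"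
          using w by (rule closed_segment_nth) (simp add: hz[OF r])
        note wz
        also have "\<dots> \<in> {0<..<1}"
          using convexD[of "{0<..<1::real}" "t $ z" "1/2" "1 - u" u] t'(2,3) u by simp
        finally show ?thesis
          by simp
      qed
      ultimately show "closed_segment t (h (radial z t)) \<subseteq> U \<inter> V"
        by (auto simp: U_def V_def)
    qed
    have "path_connected (U \<inter> V)"
      unfolding path_connected_component
    proof (intro ballI)
      fix s t
      assume st: "s \<in> U \<inter> V" "t \<in> U \<inter> V"
      have "radial z s \<in> ?L" "radial z t \<in> ?L"
        using st radial_in_link by (auto simp: U_def V_def)
      then show "path_component (U \<inter> V) s t"
        using image to_image st by (meson path_component_sym path_component_trans)
    qed
    moreover obtain x where "x \<in> P" "x < z \<or> z < x"
      using link unfolding order_connected_def by auto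
    then have "h (axis x 1) \<in> U \<inter> V"
      using hUV by (simp add: axis_in_poset_realization)
    ultimately show ?thesis
      by auto
  qed
  ultimately show ?thesis
    using simply_connected_Un_open[of U V] unfolding UV by blast
qed

section \<open>Spanning sets of a matroid\<close>

lemma order_connectedI:
  assumes c: "c \<in> P"
    and reach: "\<And>x. x \<in> P \<Longrightarrow> (comparable_on P)\<^sup>*\<^sup>* x c"
  shows "order_connected P"
proof -
  have "symp (comparable_on P)\<^sup>*\<^sup>*"
    by (rule symp_rtranclp) (auto simp: symp_def comparable_on_def)
  then have "(comparable_on P)\<^sup>*\<^sup>* x y" if "x \<in> P" "y \<in> P" for x y
    using reach[OF that(1)] reach[OF that(2)] by (meson rtranclp_trans sympD)
  then show ?thesis
    using c unfolding order_connected_def by blast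
qed

section \<open>Augmentation, bases and basis exchange\<close>

locale finite_matroid =
  fixes M :: "'a matroid"
  assumes is_matroid: "is_matroid M"
begin

lemma finite_ground: "finite (ground M)"
  and indep_ground: "I \<in> indep M \<Longrightarrow> I \<subseteq> ground M"
  and empty_indep: "{} \<in> indep M"
  and indep_subset: "I \<in> indep M \<Longrightarrow> J \<subseteq> I \<Longrightarrow> J \<in> indep M"
  and augment: "I \<in> indep M \<Longrightarrow> J \<in> indep M \<Longrightarrow> card I < card J \<Longrightarrow> \<exists>x\<in>J - I. insert x I \<in> indep M"
  using is_matroid unfolding is_matroid_def by blast+

lemma finite_indep: "I \<in> indep M \<Longrightarrow> finite I"
  using finite_ground indep_ground finite_subset by blast

lemma finite_indep_family: "finite (indep M)"
  using finite_ground indep_ground by (meson Pow_iff finite_Pow_iff finite_subset subsetI)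

text \<open>Iterated augmentation. The bound \<open>K \<subseteq> I \<union> J\<close> later keeps
  extended bases inside a prescribed set.\<close>

lemma extend_indep:
  assumes "I \<in> indep M" "J \<in> indep M" "card I \<le> card J"
  shows "\<exists>K\<in>indep M. I \<subseteq> K \<and> K \<subseteq> I \<union> J \<and> card K = card J"
  using assms
proof (induction "card J - card I" arbitrary: I)
  case 0
  then show ?case
    by auto
next
  case (Suc n)
  then have "card I < card J" and n: "n = card J - Suc (card I)"
    by simp_all
  then obtain x where x: "x \<in> J - I" "insert x I \<in> indep M"
    using augment[of I J] Suc.prems by blast
  have "card (insert x I) = Suc (card I)"
    using x Suc.prems(1) finite_indep by simp
  then obtain K where "K \<in> indep M" "insert x I \<subseteq> K" "K \<subseteq> insert x I \<union> J" "card K = card J"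
    using Suc.hyps(1)[of "insert x I"] Suc.prems(2) x n \<open>card I < card J\<close> by auto
  then show ?case
    using x by blast
qed

lemma card_indep_le_rank: "I \<in> indep M \<Longrightarrow> card I \<le> matroid_rank M"
  unfolding matroid_rank_def using finite_indep_family by (intro Max_ge) auto

lemma ex_indep_card_rank: "\<exists>B\<in>indep M. card B = matroid_rank M"
proof -
  have "matroid_rank M \<in> card ` indep M"
    unfolding matroid_rank_def by (rule Max_in) (use finite_indep_family empty_indep in auto)
  then show ?thesis
    by auto
qed

text \<open>An inclusion-maximal independent set has maximum size, since otherwise it could be
  extended from a larger one.\<close>

lemma bases_iff: "B \<in> bases M \<longleftrightarrow> B \<in> indep M \<and> card B = matroid_rank M"
proof
  assume B: "B \<in> bases M"
  then have "B \<in> indep M" "\<And>I. I \<in> indep M \<Longrightarrow> B \<subseteq> I \<Longrightarrow> I = B"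
    unfolding bases_def by auto
  moreover obtain B' where "B' \<in> indep M" "card B' = matroid_rank M"
    using ex_indep_card_rank by blast
  ultimately show "B \<in> indep M \<and> card B = matroid_rank M"
    using extend_indep[of B B'] card_indep_le_rank by metis
next
  assume B: "B \<in> indep M \<and> card B = matroid_rank M"
  then have "I = B" if "I \<in> indep M" "B \<subseteq> I" for I
    using that card_indep_le_rank finite_indep by (metis card_seteq)
  then show "B \<in> bases M"
    using B unfolding bases_def by auto
qed

lemma extend_basis:
  assumes "I \<in> indep M" "B \<in> bases M"
  shows "\<exists>B'\<in>bases M. I \<subseteq> B' \<and> B' \<subseteq> I \<union> B"
  using extend_indep[of I B] assms card_indep_le_rank bases_iff by metis

definition spanning :: "'a set set" where
  "spanning = {T. T \<subseteq> ground M \<and> (\<exists>B\<in>bases M. B \<subseteq> T)}"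

lemma bases_spanning: "B \<in> bases M \<Longrightarrow> B \<in> spanning"
  using indep_ground[of B] by (auto simp: spanning_def bases_iff)

lemma spanning_mono: "U \<in> spanning \<Longrightarrow> U \<subseteq> T \<Longrightarrow> T \<subseteq> ground M \<Longrightarrow> T \<in> spanning"
  unfolding spanning_def by blast

lemma ex_basis_between:
  assumes "F \<in> indep M" "F \<subseteq> T" "T \<in> spanning"
  shows "\<exists>B\<in>bases M. F \<subseteq> B \<and> B \<subseteq> T"
proof -
  obtain B where "B \<in> bases M" "B \<subseteq> T"
    using assms(3) unfolding spanning_def by blast
  then show ?thesis
    using extend_basis[OF assms(1), of B] assms(2) by blast
qed

text \<open>One exchange goes from \<open>B\<close> up to \<open>insert y B\<close> and down to
  \<open>B\<close> with \<open>x\<close> replaced by \<open>y\<close>, which brings the basis closer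
  to \<open>B'\<close>. The middle set has one element more than a basis and is therefore still a
  proper subset of \<open>T\<close>.\<close>

lemma bases_linked:
  assumes T: "T \<subseteq> ground M" "card T \<ge> matroid_rank M + 2"
    and "B \<in> bases M" "B' \<in> bases M" "F \<subseteq> B" "F \<subseteq> B'" "B \<subseteq> T" "B' \<subseteq> T"
  defines "P \<equiv> {U \<in> spanning. F \<subseteq> U \<and> U \<subset> T}"
  shows "(comparable_on P)\<^sup>*\<^sup>* B B'"
  using assms(3-8)
proof (induction "card (B' - B)" arbitrary: B rule: less_induct)
  case less
  have B: "B \<in> indep M" "card B = matroid_rank M" "finite B"
    and B': "B' \<in> indep M" "card B' = matroid_rank M" "finite B'"
    using less.prems(1,2) finite_indep unfolding bases_iff by auto
  \<comment> \<open>\<open>T\<close> has at least rank + 2 elements, so a subset with at most rank +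
    1 elements is proper.\<close>
  have in_P: "U \<in> P" if "C \<in> bases M" "C \<subseteq> U" "F \<subseteq> U" "U \<subseteq> T" "card U \<le> matroid_rank M + 1" for C U
    using that T bases_spanning spanning_mono[of C U] unfolding P_def by auto
  show ?case
  proof (cases "B = B'")
    case False
    then have "\<not> B \<subseteq> B'"
      using B B' by (metis card_subset_eq)
    then obtain x where x: "x \<in> B" "x \<notin> B'"
      by blast
    have "card (B - {x}) < card B'"
      using B B' x by (metis card_Diff1_less)
    then obtain y where y: "y \<in> B'" "y \<notin> B - {x}" "insert y (B - {x}) \<in> indep M"
      using augment[of "B - {x}" B'] indep_subset[OF B(1), of "B - {x}"] B'(1) by blast
    then have "y \<notin> B"
      using x by auto
    define C where "C = insert y (B - {x})"
    have "card C = card B"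
      using B(3) x(1) y(2) unfolding C_def by (metis card_Suc_Diff1 card_insert_disjoint finite_Diff)
    \<comment> \<open>\<open>x\<close> lies outside \<open>B'\<close> and so outside
      \<open>F\<close>; removing it keeps \<open>F\<close> inside \<open>C\<close>.\<close>
    then have C: "C \<in> bases M" "F \<subseteq> C" "C \<subseteq> T"
      using y less.prems B x unfolding bases_iff C_def by auto
    have "B' - C \<subset> B' - B"
      using x y \<open>y \<notin> B\<close> unfolding C_def by blast
    then have "card (B' - C) < card (B' - B)"
      using B'(3) by (simp add: psubset_card_mono)
    then have "(comparable_on P)\<^sup>*\<^sup>* C B'"
      by (rule less.hyps) (use C less.prems in auto)
    moreover have "B \<in> P" "C \<in> P" "insert y B \<in> P"
      using in_P[of B B] in_P[of C C] in_P[of B "insert y B"] less.prems C B y(1) \<open>card C = card B\<close> \<open>y \<notin> B\<close>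
      by auto
    then have "comparable_on P B (insert y B)" "comparable_on P (insert y B) C"
      by (auto simp: C_def comparable_on_def)
    ultimately show ?thesis
      by (meson converse_rtranclp_into_rtranclp)
  qed simp
qed

text \<open>Each such set lies above a basis containing \<open>F\<close>, and these bases are linked
  by exchange.\<close>

lemma proper_spanning_connected:
  assumes T: "T \<in> spanning" "card T \<ge> matroid_rank M + 2" and F: "F \<in> indep M" "F \<subseteq> T"
  shows "order_connected {U \<in> spanning. F \<subseteq> U \<and> U \<subset> T}"
proof -
  let ?P = "{U \<in> spanning. F \<subseteq> U \<and> U \<subset> T}"
  have ground: "T \<subseteq> ground M"
    using T(1) unfolding spanning_def by blast
  have bases_P: "C \<in> ?P" if "C \<in> bases M" "F \<subseteq> C" "C \<subseteq> T" for C
    using that T(2) bases_spanning unfolding bases_iff by auto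
  obtain B where B: "B \<in> bases M" "F \<subseteq> B" "B \<subseteq> T"
    using ex_basis_between F T(1) by blast
  show ?thesis
  proof (rule order_connectedI)
    show "B \<in> ?P"
      using B bases_P by blast
    fix U
    assume U: "U \<in> ?P"
    then obtain C where C: "C \<in> bases M" "F \<subseteq> C" "C \<subseteq> U"
      using ex_basis_between F(1) by blast
    have "(comparable_on ?P)\<^sup>*\<^sup>* C B"
      by (intro bases_linked[OF ground T(2) C(1) B(1) C(2) B(2) _ B(3)]) (use C U in auto)
    moreover have "C \<in> ?P"
      by (rule bases_P) (use C U in auto)
    then have "comparable_on ?P U C"
      using U C(3) unfolding comparable_on_def by simp
    ultimately show "(comparable_on ?P)\<^sup>*\<^sup>* U B"
      by (meson converse_rtranclp_into_rtranclp)
  qed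
qed

end

text \<open>The abstract form of what is used about regular sets: heredity among spanning sets, and
  the presence of every spanning set that exceeds the rank by at most 2.\<close>

locale spanning_family = finite_matroid M for M :: "'a::finite matroid" +
  fixes Q :: "'a set set"
  assumes family_spanning: "Q \<subseteq> spanning"
    and family_down: "T \<in> Q \<Longrightarrow> U \<in> spanning \<Longrightarrow> U \<subseteq> T \<Longrightarrow> U \<in> Q"
    and family_small: "T \<in> spanning \<Longrightarrow> card T \<le> matroid_rank M + 2 \<Longrightarrow> T \<in> Q"
begin

text \<open>\<open>R\<close> interpolates between the members containing \<open>insert e F\<close>
  and all members above \<open>F\<close> that stay in \<open>Q\<close> when \<open>e\<close> is
  added. The induction removes an inclusion-minimal \<open>T\<close> lacking \<open>e\<close>. Its
  link lies entirely above it, and each \<open>U\<close> there is joined to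
  \<open>insert e T\<close> through \<open>insert e U\<close>.\<close>

lemma simply_connected_extendable:
  assumes sc: "simply_connected (poset_realization {T \<in> Q. insert e F \<subseteq> T})"
    and R: "{T \<in> Q. insert e F \<subseteq> T} \<subseteq> R" "R \<subseteq> {T \<in> Q. F \<subseteq> T \<and> insert e T \<in> Q}"
    and up: "\<And>T U. T \<in> R \<Longrightarrow> U \<in> Q \<Longrightarrow> insert e U \<in> Q \<Longrightarrow> T \<subseteq> U \<Longrightarrow> U \<in> R"
  shows "simply_connected (poset_realization R)"
  using R up
proof (induction "card {T \<in> R. e \<notin> T}" arbitrary: R rule: less_induct)
  case less
  show ?case
  proof (cases "{T \<in> R. e \<notin> T} = {}")
    case True
    then have "R \<subseteq> {T \<in> Q. insert e F \<subseteq> T}"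
      using less.prems(2) by auto
    then have "R = {T \<in> Q. insert e F \<subseteq> T}"
      using less.prems(1) by (rule subset_antisym)
    then show ?thesis
      using sc by simp
  next
    case False
    then obtain T where T: "T \<in> R" "e \<notin> T" and min: "\<And>U. U \<in> R \<Longrightarrow> e \<notin> U \<Longrightarrow> U \<subseteq> T \<Longrightarrow> U = T"
      using finite_has_minimal[of "{T \<in> R. e \<notin> T}"] by (auto simp: finite)
    \<comment> \<open>\<open>insert e U\<close> contains \<open>insert e F\<close> and lies in
      \<open>Q\<close>, so it is in the starting family and hence in \<open>R\<close>.\<close>
    have above: "insert e U \<in> R" if "U \<in> R" for U
      using less.prems(1,2) that by blast
    let ?P = "{U \<in> R. U < T \<or> T < U}"
    have P: "?P = {U \<in> R. T \<subset> U}"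
      using min T(2) by blast
    show ?thesis
    proof (rule simply_connected_insert[OF T(1)])
      have "{U \<in> R - {T}. e \<notin> U} \<subset> {U \<in> R. e \<notin> U}"
        using T by auto
      then have "card {U \<in> R - {T}. e \<notin> U} < card {U \<in> R. e \<notin> U}"
        by (simp add: psubset_card_mono)
      then show "simply_connected (poset_realization (R - {T}))"
      proof (rule less.hyps)
        \<comment> \<open>\<open>U = T\<close> is impossible: \<open>S\<close> would then be a
          subset of \<open>T\<close> lacking \<open>e\<close>, and minimality would give
          \<open>S = T\<close>.\<close>
        show "U \<in> R - {T}" if "S \<in> R - {T}" "U \<in> Q" "insert e U \<in> Q" "S \<subseteq> U" for S U
          using that less.prems(3)[of S U] min[of S] T(2) by auto
      qed (use less.prems T in auto)
      show "order_connected ?P"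
        unfolding P
      proof (rule order_connectedI)
        show "insert e T \<in> {U \<in> R. T \<subset> U}"
          using above T by auto
        fix U
        assume U: "U \<in> {U \<in> R. T \<subset> U}"
        let ?P = "{U \<in> R. T \<subset> U}"
        have "comparable_on ?P U (insert e U)" "comparable_on ?P (insert e U) (insert e T)"
          using U above T unfolding comparable_on_def by auto
        then show "(comparable_on ?P)\<^sup>*\<^sup>* U (insert e T)"
          by (meson converse_rtranclp_into_rtranclp rtranclp.rtrancl_refl)
      qed
    qed
  qed
qed

text \<open>The members \<open>T\<close> with \<open>insert e T\<close> outside \<open>Q\<close> are
  removed starting from a maximal one. Its link lies entirely below it and consists of all proper
  spanning subsets of \<open>T\<close> containing \<open>F\<close>, which basis exchange
  connects.\<close>

lemma simply_connected_down_closed: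
  assumes F: "F \<in> indep M" and e: "e \<in> ground M"
    and sc: "simply_connected (poset_realization {T \<in> Q. F \<subseteq> T \<and> insert e T \<in> Q})"
    and R: "{T \<in> Q. F \<subseteq> T \<and> insert e T \<in> Q} \<subseteq> R" "R \<subseteq> {T \<in> Q. F \<subseteq> T}"
    and down: "\<And>T U. T \<in> R \<Longrightarrow> U \<in> spanning \<Longrightarrow> F \<subseteq> U \<Longrightarrow> U \<subseteq> T \<Longrightarrow> U \<in> R"
  shows "simply_connected (poset_realization R)"
  using R down
proof (induction "card {T \<in> R. insert e T \<notin> Q}" arbitrary: R rule: less_induct)
  case less
  show ?case
  proof (cases "{T \<in> R. insert e T \<notin> Q} = {}")
    case True
    then have "R \<subseteq> {T \<in> Q. F \<subseteq> T \<and> insert e T \<in> Q}"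
      using less.prems(2) by auto
    then have "R = {T \<in> Q. F \<subseteq> T \<and> insert e T \<in> Q}"
      using less.prems(1) by (rule subset_antisym)
    then show ?thesis
      using sc by simp
  next
    case False
    then obtain T where T: "T \<in> R" "insert e T \<notin> Q"
      and max': "\<And>U. U \<in> R \<Longrightarrow> insert e U \<notin> Q \<Longrightarrow> T \<subseteq> U \<Longrightarrow> U = T"
      using finite_has_maximal[of "{T \<in> R. insert e T \<notin> Q}"] by (auto simp: finite)
    have TQ: "T \<in> Q" "F \<subseteq> T"
      using T(1) less.prems(2) by auto
    then have "T \<in> spanning" "T \<subseteq> ground M"
      using family_spanning unfolding spanning_def by auto
    then have span: "T \<in> spanning" "insert e T \<in> spanning"
      using e spanning_mono[of T "insert e T"] by auto
    \<comment> \<open>If \<open>insert e U\<close> were in \<open>Q\<close>, heredity would put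
      \<open>insert e T\<close> in \<open>Q\<close>. So a member above \<open>T\<close> is also
      non-extendable, and \<open>T\<close> is maximal in all of \<open>R\<close>.\<close>
    have max: "U = T" if "U \<in> R" "T \<subseteq> U" for U
    proof (rule max'[OF that(1) _ that(2)])
      show "insert e U \<notin> Q"
        using family_down[of "insert e U" "insert e T"] span(2) T(2) that(2) by blast
    qed
    have "card (insert e T) > matroid_rank M + 2"
      using family_small[OF span(2)] T(2) by force
    \<comment> \<open>A spanning set outside \<open>Q\<close> has at least rank + 3 elements, and
      dropping \<open>e\<close> costs at most one: exactly the size that basis exchange inside
      \<open>T\<close> requires.\<close>
    then have card: "card T \<ge> matroid_rank M + 2"
      using card_insert_le_m1[of "card T + 1" T e] by (simp add: card_insert_if split: if_splits)
    have "{U \<in> R. U < T \<or> T < U} = {U \<in> spanning. F \<subseteq> U \<and> U \<subset> T}"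
      using less.prems(2,3) T(1) max family_spanning by blast
    then have link: "order_connected {U \<in> R. U < T \<or> T < U}"
      using proper_spanning_connected[OF span(1) card F TQ(2)] by simp
    show ?thesis
    proof (rule simply_connected_insert[OF T(1) _ link])
      have "{U \<in> R - {T}. insert e U \<notin> Q} \<subset> {U \<in> R. insert e U \<notin> Q}"
        using T by auto
      then have "card {U \<in> R - {T}. insert e U \<notin> Q} < card {U \<in> R. insert e U \<notin> Q}"
        by (simp add: psubset_card_mono)
      then show "simply_connected (poset_realization (R - {T}))"
      proof (rule less.hyps)
        show "U \<in> R - {T}" if "S \<in> R - {T}" "U \<in> spanning" "F \<subseteq> U" "U \<subseteq> S" for S U
          using that less.prems(3)[of S U] max[of S] by auto
      qed (use less.prems T in auto)
    qed
  qed
qed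

text \<open>Induction from bases down to smaller \<open>F\<close>. Passing from
  \<open>insert e F\<close> to \<open>F\<close> takes two stages: first the members that remain in
  \<open>Q\<close> when \<open>e\<close> is added, then the others.\<close>

lemma simply_connected_above_indep:
  assumes "F \<in> indep M"
  shows "simply_connected (poset_realization {T \<in> Q. F \<subseteq> T})"
  using assms
proof (induction "matroid_rank M - card F" arbitrary: F)
  case 0
  then have F: "F \<in> bases M"
    using card_indep_le_rank[of F] unfolding bases_iff by simp
  then have "F \<in> Q"
    by (intro family_small bases_spanning) (auto simp: bases_iff)
  then show ?case
    by (intro simply_connected_cone[of F]) auto
next
  case (Suc n)
  obtain B where "B \<in> indep M" "card B = matroid_rank M"
    using ex_indep_card_rank by blast
  moreover have "card F < matroid_rank M"
    using Suc.hyps(2) by simp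
  ultimately obtain e where e: "e \<notin> F" "insert e F \<in> indep M"
    using augment[of F B] Suc.prems by auto
  have eg: "e \<in> ground M"
    using e indep_ground by blast
  have "card (insert e F) = Suc (card F)"
    using e(1) finite_indep Suc.prems by simp
  then have "n = matroid_rank M - card (insert e F)"
    using Suc.hyps(2) by simp
  then have "simply_connected (poset_realization {T \<in> Q. insert e F \<subseteq> T})"
    using Suc.hyps(1) e(2) by blast
  then have "simply_connected (poset_realization {T \<in> Q. F \<subseteq> T \<and> insert e T \<in> Q})"
    by (rule simply_connected_extendable) (auto simp: insert_absorb)
  then show ?case
  proof (rule simply_connected_down_closed[OF Suc.prems eg])
    show "U \<in> {T \<in> Q. F \<subseteq> T}" if "T \<in> {T \<in> Q. F \<subseteq> T}" "U \<in> spanning" "F \<subseteq> U" "U \<subseteq> T" for T U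
      using that family_down by blast
  qed auto
qed

theorem simply_connected_family: "simply_connected (poset_realization Q)"
  using simply_connected_above_indep[OF empty_indep] by simp

end

section \<open>Minors and corank\<close>

context finite_matroid
begin

lemma indep_delete_dual:
  "indep (delete (dual M) X) = {I. I \<subseteq> ground M - X \<and> (\<exists>B\<in>bases M. I \<inter> B = {})}"
  by (auto simp: delete_def dual_def)

lemma ground_contract: "ground (contract M X) = ground M - X"
  by (simp add: contract_def dual_def delete_def)

lemma indep_contract:
  "indep (contract M X) =
     {I. I \<subseteq> ground M - X \<and> (\<exists>D\<in>bases (delete (dual M) X). I \<inter> D = {})}"
  by (simp add: contract_def dual_def delete_def)

text \<open>Recovers the usual description of contraction from its definition by duality. The bases
  of \<open>delete (dual M) X\<close> are the sets \<open>ground M - X - B\<close> where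
  \<open>B\<close> is a basis meeting \<open>X\<close> in as many elements as possible.\<close>

lemma indep_contract_iff:
  assumes X: "X \<subseteq> ground M"
  shows "I \<in> indep (contract M X) \<longleftrightarrow> I \<subseteq> ground M - X \<and>
    (\<exists>J\<in>indep M. J \<subseteq> X \<and> (\<forall>J'\<in>indep M. J' \<subseteq> X \<longrightarrow> card J' \<le> card J) \<and> I \<union> J \<in> indep M)"
    (is "?lhs \<longleftrightarrow> _ \<and> ?J")
proof -
  let ?N = "delete (dual M) X"
  have lhs_iff: "?lhs \<longleftrightarrow> I \<subseteq> ground M - X \<and> (\<exists>D\<in>bases ?N. I \<inter> D = {})"
    by (simp add: indep_contract)
  have only_if: ?J if D: "D \<in> bases ?N" "I \<inter> D = {}" and I: "I \<subseteq> ground M - X" for D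
  proof -
    have "D \<in> indep ?N" and maximal: "\<And>D'. D' \<in> indep ?N \<Longrightarrow> D \<subseteq> D' \<Longrightarrow> D' = D"
      using D(1) unfolding bases_def by auto
    then obtain B where B: "B \<in> bases M" "D \<inter> B = {}" and DX: "D \<subseteq> ground M - X"
      unfolding indep_delete_dual by auto
    then have Bi: "B \<in> indep M" "card B = matroid_rank M"
      by (simp_all add: bases_iff)
    have "ground M - X - B \<in> indep ?N"
      using B(1) unfolding indep_delete_dual by auto
    then have D_eq: "ground M - X - B = D"
      by (rule maximal) (use B DX in auto)
    have "card J' \<le> card (B \<inter> X)" if J': "J' \<in> indep M" "J' \<subseteq> X" for J'
    proof (rule ccontr)
      assume "\<not> card J' \<le> card (B \<inter> X)"
      then obtain x where x: "x \<in> J' - B \<inter> X" "insert x (B \<inter> X) \<in> indep M"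
        using augment[of "B \<inter> X" J'] J'(1) indep_subset[OF Bi(1), of "B \<inter> X"] by auto
      \<comment> \<open>If \<open>x\<close> could be added to \<open>B \<inter> X\<close>, some
        basis \<open>B'\<close> would lie between the enlarged set and \<open>insert x B\<close>.
        Maximality of \<open>D\<close> makes \<open>B'\<close> keep all of \<open>B\<close> outside
        \<open>X\<close>, so \<open>B'\<close> contains \<open>insert x B\<close> and is too
        large.\<close>
      then obtain B' where B': "B' \<in> bases M" "insert x (B \<inter> X) \<subseteq> B'" "B' \<subseteq> insert x (B \<inter> X) \<union> B"
        using extend_basis[OF _ B(1)] by blast
      have xX: "x \<in> X" "x \<notin> B"
        using x(1) J'(2) by auto
      have "ground M - X - B' \<in> indep ?N"
        using B'(1) unfolding indep_delete_dual by auto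
      then have "ground M - X - B' = D"
        by (rule maximal) (use D_eq B'(3) xX in auto)
      then have "insert x B \<subseteq> B'"
        using B'(2) D_eq indep_ground[OF Bi(1)] by auto
      then have "card (insert x B) \<le> card B'"
        using B'(1) finite_indep[of B'] by (intro card_mono) (simp_all add: bases_iff)
      then show False
        using xX(2) Bi B'(1) finite_indep[OF Bi(1)] unfolding bases_iff by simp
    qed
    moreover have "I \<subseteq> B"
      using I D(2) D_eq by blast
    then have "I \<union> (B \<inter> X) \<in> indep M"
      by (intro indep_subset[OF Bi(1)]) auto
    moreover have "B \<inter> X \<in> indep M"
      by (rule indep_subset[OF Bi(1)]) auto
    ultimately show ?J
      by blast
  qed
  have "if": ?lhs if J: "J \<in> indep M" "J \<subseteq> X" "\<forall>J'\<in>indep M. J' \<subseteq> X \<longrightarrow> card J' \<le> card J"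
      "I \<union> J \<in> indep M" and I: "I \<subseteq> ground M - X" for J
  proof -
    obtain B0 where "B0 \<in> bases M"
      using ex_indep_card_rank unfolding bases_iff by blast
    then obtain B where B: "B \<in> bases M" "I \<union> J \<subseteq> B"
      using extend_basis[OF J(4)] by blast
    have "D' = ground M - X - B" if D': "D' \<in> indep ?N" "ground M - X - B \<subseteq> D'" for D'
    proof (rule ccontr)
      assume "D' \<noteq> ground M - X - B"
      then obtain y where y: "y \<in> D'" "y \<notin> ground M - X - B"
        using D'(2) by blast
      obtain B2 where B2: "B2 \<in> bases M" "D' \<inter> B2 = {}" and D'X: "D' \<subseteq> ground M - X"
        using D'(1) unfolding indep_delete_dual by auto
      have fin: "finite B" "finite B2"
        using B(1) B2(1) finite_indep unfolding bases_iff by auto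
      \<comment> \<open>A strictly larger \<open>D'\<close> avoids a basis \<open>B2\<close> with
        fewer elements outside \<open>X\<close> than \<open>B\<close>, hence more inside
        \<open>X\<close>, against the choice of \<open>J\<close>.\<close>
      have "B2 - X \<subset> B - X"
        using y D'X D'(2) B2 indep_ground[of B2] unfolding bases_iff by blast
      then have "card (B2 - X) < card (B - X)"
        using fin by (simp add: psubset_card_mono)
      moreover have "card B2 = card B"
        using B(1) B2(1) unfolding bases_iff by simp
      ultimately have "card (B \<inter> X) < card (B2 \<inter> X)"
        using card_Int_Diff[OF fin(1), of X] card_Int_Diff[OF fin(2), of X] by simp
      moreover have "card (B2 \<inter> X) \<le> card J"
        using J(3) B2(1) indep_subset[of B2 "B2 \<inter> X"] unfolding bases_iff by blast
      moreover have "card J \<le> card (B \<inter> X)"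
        using J(2) B(2) fin by (intro card_mono) auto
      ultimately show False
        by simp
    qed
    moreover have "ground M - X - B \<in> indep ?N"
      using B(1) unfolding indep_delete_dual by auto
    ultimately have "ground M - X - B \<in> bases ?N"
      unfolding bases_def by blast
    moreover have "I \<inter> (ground M - X - B) = {}"
      using B(2) by blast
    ultimately show ?lhs
      using I unfolding indep_contract by blast
  qed
  show ?thesis
  proof
    assume ?lhs
    then obtain D where "I \<subseteq> ground M - X" "D \<in> bases ?N" "I \<inter> D = {}"
      unfolding lhs_iff by blast
    then show "I \<subseteq> ground M - X \<and> ?J"
      using only_if[of D] by simp
  next
    assume "I \<subseteq> ground M - X \<and> ?J"
    then obtain J where "J \<in> indep M" "J \<subseteq> X" "\<forall>J'\<in>indep M. J' \<subseteq> X \<longrightarrow> card J' \<le> card J"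
      "I \<union> J \<in> indep M" "I \<subseteq> ground M - X"
      by blast
    then show ?lhs
      by (rule "if")
  qed
qed

text \<open>Deleting \<open>Z\<close> commutes with contracting a set \<open>X\<close> disjoint from
  \<open>Z\<close>: the independent subsets of \<open>X\<close> are unchanged, so by
  \<open>indep_contract_iff\<close> the only new condition on \<open>I\<close> is to avoid
  \<open>Z\<close>.\<close>

lemma is_minor_delete:
  assumes del: "is_matroid (delete M Z)" and minor: "is_minor N (delete M Z)"
  shows "is_minor N M"
proof -
  interpret del: finite_matroid "delete M Z"
    by unfold_locales (rule del)
  obtain X Y where XY: "X \<subseteq> ground M - Z" "Y \<subseteq> ground M - Z" "X \<inter> Y = {}"
    and N: "N = delete (contract (delete M Z) X) Y"
    using minor unfolding is_minor_def by (auto simp: delete_def)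
  have indep_del: "J \<in> indep (delete M Z) \<longleftrightarrow> J \<in> indep M \<and> J \<inter> Z = {}" for J
    using indep_ground by (auto simp: delete_def)
  have ground_del: "ground (delete M Z) = ground M - Z"
    by (simp add: delete_def)
  have "I \<in> indep (contract (delete M Z) X) \<longleftrightarrow> I \<in> indep (contract M X) \<and> I \<inter> Z = {}" for I
  proof -
    have "X \<subseteq> ground (delete M Z)" "X \<subseteq> ground M"
      using XY(1) by (auto simp: ground_del)
    have sub: "J \<in> indep (delete M Z) \<longleftrightarrow> J \<in> indep M"
      and un: "I \<union> J \<in> indep (delete M Z) \<longleftrightarrow> I \<union> J \<in> indep M \<and> I \<inter> Z = {}" if "J \<subseteq> X" for J
      using that XY(1) unfolding indep_del by blast+
    have max: "(\<forall>J'\<in>indep (delete M Z). J' \<subseteq> X \<longrightarrow> card J' \<le> k) \<longleftrightarrow>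
        (\<forall>J'\<in>indep M. J' \<subseteq> X \<longrightarrow> card J' \<le> k)" for k
      using sub by blast
    have "(\<exists>J\<in>indep (delete M Z). J \<subseteq> X \<and> (\<forall>J'\<in>indep M. J' \<subseteq> X \<longrightarrow> card J' \<le> card J) \<and>
          I \<union> J \<in> indep (delete M Z)) \<longleftrightarrow>
        (\<exists>J\<in>indep M. J \<subseteq> X \<and> (\<forall>J'\<in>indep M. J' \<subseteq> X \<longrightarrow> card J' \<le> card J) \<and>
          I \<union> J \<in> indep M) \<and> I \<inter> Z = {}"
      unfolding Bex_def by (metis (no_types, lifting) sub un)
    moreover have "I \<subseteq> ground M - Z - X \<longleftrightarrow> I \<subseteq> ground M - X" if "I \<inter> Z = {}"
      using that by blast
    ultimately show ?thesis
      unfolding indep_contract_iff[OF \<open>X \<subseteq> ground M\<close>]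
        del.indep_contract_iff[OF \<open>X \<subseteq> ground (delete M Z)\<close>] ground_del max
      by (cases "I \<inter> Z = {}") simp_all
  qed
  then have indep_eq: "indep (contract (delete M Z) X) = {I \<in> indep (contract M X). I \<inter> Z = {}}"
    by blast
  \<comment> \<open>\<open>Z\<close> may stick out of the ground set, while \<open>is_minor\<close>
    asks for subsets of it; hence the intersection.\<close>
  have "N = delete (contract M X) (Y \<union> Z \<inter> ground M)"
    unfolding N delete_def[of "contract (delete M Z) X"] delete_def[of "contract M X"]
      indep_eq del.ground_contract ground_contract ground_del
    by auto
  moreover have "X \<subseteq> ground M" "Y \<union> Z \<inter> ground M \<subseteq> ground M" "X \<inter> (Y \<union> Z \<inter> ground M) = {}"
    using XY by blast+
  ultimately show ?thesis
    unfolding is_minor_def by blast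
qed

text \<open>Corank does not grow in minors. A basis \<open>D\<close> of the dual with
  \<open>X\<close> deleted avoids some basis of \<open>M\<close>, and removing \<open>D\<close> from
  the ground set of \<open>N\<close> leaves an independent set of \<open>N\<close>.\<close>

lemma minor_corank:
  assumes minor: "is_minor N M" and B: "B \<in> bases M"
  shows "\<exists>I\<in>indep N. card (ground N - I) \<le> card (ground M - B)"
proof -
  obtain X Y where N: "N = delete (contract M X) Y"
    using minor unfolding is_minor_def by auto
  let ?D = "delete (dual M) X"
  have fin: "finite (indep ?D)"
    using finite_ground by (simp add: indep_delete_dual)
  moreover have "{} \<in> indep ?D"
    using B by (auto simp: indep_delete_dual)
  ultimately obtain D where D: "D \<in> indep ?D" "\<And>I. I \<in> indep ?D \<Longrightarrow> D \<subseteq> I \<Longrightarrow> I = D"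
    using finite_has_maximal[of "indep ?D"] by blast
  then have "D \<in> bases ?D"
    unfolding bases_def by auto
  then have "ground M - X - Y - D \<in> indep N"
    by (auto simp: N delete_def[of "contract M X"] indep_contract ground_contract)
  moreover have "card (ground N - (ground M - X - Y - D)) \<le> card (ground M - B)"
  proof -
    obtain B' where B': "B' \<in> bases M" "D \<inter> B' = {}" and "D \<subseteq> ground M"
      using D(1) unfolding indep_delete_dual by auto
    then have "ground N - (ground M - X - Y - D) \<subseteq> ground M - B'"
      by (auto simp: N delete_def ground_contract)
    then have "card (ground N - (ground M - X - Y - D)) \<le> card (ground M - B')"
      using finite_ground by (intro card_mono) auto
    also have "\<dots> = card (ground M - B)"
      using B B'(1) indep_ground finite_indep by (simp add: bases_iff card_Diff_subset)
    finally show ?thesis .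
  qed
  ultimately show ?thesis
    by (rule bexI[rotated])
qed

end

lemma matroid_iso_corank:
  assumes iso: "matroid_iso M N" and "I \<in> indep M" "I \<subseteq> ground M"
  shows "\<exists>J\<in>indep N. card (ground N - J) = card (ground M - I)"
proof -
  obtain f where f: "bij_betw f (ground M) (ground N)"
    and indep: "\<And>I. I \<subseteq> ground M \<Longrightarrow> I \<in> indep M \<longleftrightarrow> f ` I \<in> indep N"
    using iso unfolding matroid_iso_def by blast
  have "ground N - f ` I = f ` (ground M - I)"
    using f assms(3) by (auto simp: bij_betw_def inj_on_image_set_diff[of f "ground M"])
  moreover have "card (f ` (ground M - I)) = card (ground M - I)"
    using f by (intro card_image) (auto simp: bij_betw_def intro: inj_on_subset)
  ultimately show ?thesis
    using indep[OF assms(3)] assms(2) by metis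
qed

section \<open>Linear matroids over the field with two elements\<close>

interpretation linear: finite_matroid "linear_matroid S" for S :: "(bit ^ 'n::finite) set"
  by unfold_locales (rule is_matroid_linear_matroid)

lemma ground_linear_matroid: "ground (linear_matroid S) = S"
  and indep_linear_matroid: "I \<in> indep (linear_matroid S) \<longleftrightarrow> I \<subseteq> S \<and> vec.independent I"
  by (simp_all add: linear_matroid_def)

lemma delete_linear_matroid: "delete (linear_matroid S) X = linear_matroid (S - X)"
  by (auto simp: delete_def linear_matroid_def)

lemma card_independent_le: "vec.independent I \<Longrightarrow> card I \<le> CARD('n)" for I :: "(bit ^ 'n::finite) set"
  using vec.independent_card_le_dim[of I UNIV] by (simp only: vec_dim_card subset_UNIV simp_thms)

lemma ex_linear_basis: "\<exists>B :: (bit ^ 'n::finite) set. 0 \<notin> B \<and> vec.independent B \<and> card B = CARD('n)"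
proof -
  obtain B :: "(bit ^ 'n) set" where "vec.independent B" "card B = vec.dim (UNIV :: (bit ^ 'n) set)"
    using vec.basis_exists[of UNIV] by blast
  then show ?thesis
    using vec.dependent_zero[of B] vec_dim_card by metis
qed

lemma rank_linear_matroid_iff:
  "matroid_rank (linear_matroid S) = CARD('n) \<longleftrightarrow> (\<exists>B\<subseteq>S. vec.independent B \<and> card B = CARD('n))"
  for S :: "(bit ^ 'n::finite) set"
proof -
  have le: "matroid_rank (linear_matroid S) \<le> CARD('n)"
    using linear.ex_indep_card_rank[of S] card_independent_le by (metis indep_linear_matroid)
  show ?thesis
  proof
    assume "matroid_rank (linear_matroid S) = CARD('n)"
    then show "\<exists>B\<subseteq>S. vec.independent B \<and> card B = CARD('n)"
      using linear.ex_indep_card_rank[of S] unfolding indep_linear_matroid Bex_def by metis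
  next
    assume "\<exists>B\<subseteq>S. vec.independent B \<and> card B = CARD('n)"
    then obtain B where "B \<in> indep (linear_matroid S)" "card B = CARD('n)"
      unfolding indep_linear_matroid by blast
    then show "matroid_rank (linear_matroid S) = CARD('n)"
      using linear.card_indep_le_rank[of B S] le by simp
  qed
qed

lemma rank_nonzero_vectors: "matroid_rank (linear_matroid (UNIV - {0} :: (bit ^ 'n::finite) set)) = CARD('n)"
proof -
  obtain B :: "(bit ^ 'n) set" where B: "0 \<notin> B" "vec.independent B" "card B = CARD('n)"
    using ex_linear_basis by metis
  show ?thesis
    unfolding rank_linear_matroid_iff
    by (intro exI[of _ B] conjI B(2,3)) (use B(1) in blast)
qed

section \<open>The Fano matroid, its dual, and regularity by corank\<close>

lemma card_ground_fano: "card (ground fano) = 7"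
proof -
  have "(UNIV :: bit set) \<subseteq> {0, 1}"
    by (metis bit_not_zero_iff insertCI subsetI)
  then have "(UNIV :: bit set) = {0, 1}"
    by (intro subset_antisym subset_UNIV)
  then have "CARD(bit) = card {0, 1 :: bit}"
    by (rule arg_cong)
  then have "CARD(bit) = 2"
    by simp
  then have "CARD(bit ^ 3) = 8"
    by simp
  then show ?thesis
    by (simp add: fano_def linear_matroid_def card_Diff_singleton)
qed

text \<open>Independent sets have at most 3 of the 7 elements, so at least 4 remain.\<close>

lemma corank_fano:
  assumes "J \<in> indep fano"
  shows "2 < card (ground fano - J)"
proof -
  have "card J \<le> 3"
    using assms card_independent_le[of J] by (simp add: fano_def indep_linear_matroid)
  moreover have "card (ground fano) - card J \<le> card (ground fano - J)"
    by (rule diff_card_le_card_Diff) simp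
  ultimately show ?thesis
    by (simp add: card_ground_fano)
qed

text \<open>The complement of \<open>J\<close> contains a basis of \<open>fano\<close>, which has 3
  elements.\<close>

lemma corank_dual_fano:
  assumes "J \<in> indep (dual fano)"
  shows "2 < card (ground (dual fano) - J)"
proof -
  obtain B where B: "B \<in> bases fano" "J \<inter> B = {}"
    using assms by (auto simp: dual_def)
  then have "card B = 3" "B \<subseteq> ground fano"
    using linear.indep_ground[of B "UNIV - {0}"] rank_nonzero_vectors[where 'n = 3]
    unfolding fano_def linear.bases_iff by simp_all
  moreover have "card B \<le> card (ground fano - J)"
    using B(2) \<open>B \<subseteq> ground fano\<close> by (intro card_mono) auto
  ultimately show ?thesis
    by (simp add: dual_def)
qed

text \<open>\<open>linear_matroid T\<close> is a deletion of \<open>linear_matroid S\<close>, so an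
  excluded minor of the former is one of the latter.\<close>

lemma regular_subset:
  assumes "regular (linear_matroid S)" "T \<subseteq> S"
  shows "regular (linear_matroid T)"
proof -
  have "linear_matroid T = delete (linear_matroid S) (S - T)"
    using assms(2) by (simp add: delete_linear_matroid double_diff)
  then have "is_minor N (linear_matroid S)" if "is_minor N (linear_matroid T)" for N
    using that linear.is_minor_delete[of S "S - T" N] is_matroid_linear_matroid[of T] by simp
  then show ?thesis
    using assms(1) binary_linear_matroid unfolding regular_def has_minor_iso_def by blast
qed

text \<open>The corank is at most 2 here and so in every minor, whereas both excluded minors have
  corank above 2.\<close>

lemma regular_small_corank:
  fixes S :: "(bit ^ 'n::finite) set"
  assumes "card S \<le> matroid_rank (linear_matroid S) + 2"
  shows "regular (linear_matroid S)"
proof -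
  have no_minor: "\<not> has_minor_iso (linear_matroid S) N"
    if corank: "\<And>J. J \<in> indep N \<Longrightarrow> 2 < card (ground N - J)" for N :: "'b matroid"
  proof
    assume "has_minor_iso (linear_matroid S) N"
    then obtain M' where M': "is_minor M' (linear_matroid S)" "matroid_iso M' N"
      unfolding has_minor_iso_def by blast
    obtain B where B: "B \<in> bases (linear_matroid S)"
      using linear.ex_indep_card_rank unfolding linear.bases_iff by blast
    obtain I where I: "I \<in> indep M'" "card (ground M' - I) \<le> card (S - B)"
      using linear.minor_corank[OF M'(1) B] by (auto simp: ground_linear_matroid)
    have "card (S - B) \<le> 2"
      using B assms linear.indep_ground[of B S]
      by (simp add: linear.bases_iff card_Diff_subset ground_linear_matroid)
    moreover have "I \<subseteq> ground M'"
      using M'(1) I(1) unfolding is_minor_def by (auto simp: delete_def)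
    then obtain J where "J \<in> indep N" "card (ground N - J) = card (ground M' - I)"
      using matroid_iso_corank[OF M'(2) I(1)] by blast
    ultimately show False
      using corank[of J] I(2) by simp
  qed
  show ?thesis
    unfolding regular_def
    using binary_linear_matroid no_minor corank_fano corank_dual_fano by blast
qed

text \<open>Nonemptiness is stated separately because \<open>simply_connected\<close> also holds for
  the empty set.\<close>

theorem theorem2p13:
  shows "poset_realization (IR :: (bit ^ 'n::finite) set set) \<noteq> {} \<and>
         simply_connected (poset_realization (IR :: (bit ^ 'n) set set))"
proof -
  let ?M = "linear_matroid (UNIV - {0} :: (bit ^ 'n) set)"
  \<comment> \<open>Within the matroid of all nonzero vectors, spanning means having full rank, so
    \<open>IR\<close> is the family of regular spanning sets.\<close>
  have spanning_iff: "T \<in> finite_matroid.spanning ?M \<longleftrightarrow>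
      T \<subseteq> UNIV - {0} \<and> matroid_rank (linear_matroid T) = CARD('n)" for T
  proof -
    have "B \<in> bases ?M \<longleftrightarrow> B \<subseteq> UNIV - {0} \<and> vec.independent B \<and> card B = CARD('n)" for B
      by (simp only: linear.bases_iff rank_nonzero_vectors indep_linear_matroid conj_assoc)
    then show ?thesis
      unfolding linear.spanning_def rank_linear_matroid_iff ground_linear_matroid mem_Collect_eq
      by (meson subset_trans)
  qed
  interpret spanning_family ?M IR
  proof unfold_locales
    show "IR \<subseteq> finite_matroid.spanning ?M"
      by (auto simp: IR_def spanning_iff)
    show "U \<in> IR" if "T \<in> IR" "U \<in> finite_matroid.spanning ?M" "U \<subseteq> T" for T U
      using that regular_subset unfolding IR_def spanning_iff by blast
    show "T \<in> IR" if "T \<in> finite_matroid.spanning ?M" "card T \<le> matroid_rank ?M + 2" for T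
      using that regular_small_corank[of T] unfolding IR_def spanning_iff rank_nonzero_vectors by simp
  qed
  obtain B where "B \<in> bases ?M"
    using linear.ex_indep_card_rank unfolding linear.bases_iff by blast
  \<comment> \<open>A basis is spanning and its size is the rank, so \<open>family_small\<close>
    places it in \<open>IR\<close>.\<close>
  then have "B \<in> IR"
    by (intro family_small linear.bases_spanning) (simp_all add: linear.bases_iff)
  then have "axis B 1 \<in> poset_realization IR"
    by (simp add: axis_in_poset_realization)
  then show ?thesis
    using simply_connected_family by blast
qed

end
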